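(* Let $\mathcal{C}$ be a hypergraph. (i) If $\psi(\mathcal{C})\ge 2$, then $\operatorname{Ind}(\mathcal{C})$ is path-connected. (ii) If $\psi(\mathcal{C})\ge 3$, then $\operatorname{Ind}(\mathcal{C})$ is simply-connected.
   Context: A hypergraph $\mathcal{C}$ on a finite vertex set $V$ is a family of pairwise incomparable subsets of $V$ (its edges), each of cardinality at least $2$; vertices lying in no edge are allowed. The independence complex $\operatorname{Ind}(\mathcal{C})$ is the simplicial complex on $V$ whose faces are the subsets of $V$ containing no edge of $\mathcal{C}$. For an edge $F$: $\mathcal{C}-F$ is the hypergraph on $V$ with edge set $\mathcal{C}\setminus\{F\}$; $N_{\mathcal{C}}(F)=\bigcup\{E\setminus F : E\in\mathcal{C},\ |E\setminus F|=1\}$; and $\mathcal{C}:F$ is the hypergraph on $V\setminus(F\cup N_{\mathcal{C}}(F))$ whose edges are the members of cardinality at least $2$ among the inclusion-minimal members of the family $\{E\setminus F : E\in \mathcal{C}-F\}$. The number $\psi(\mathcal{C})\in\mathbb{Z}_{\ge 0}\cup\{\infty\}$ is defined recursively: $\psi(\mathcal{C})=0$ if $V=\emptyset$; $\psi(\mathcal{C})=\infty$ if $V\neq\emptyset$ and $\mathcal{C}$ has no edges; otherwise $\psi(\mathcal{C})=\max_{F\in\mathcal{C}}\min\{\psi(\mathcal{C}-F),\ \psi(\mathcal{C}:F)+|F|-1\}$. *)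

theory Defs
  imports "HOL-Analysis.Analysis" "HOL-Library.Extended_Nat"
begin

definition hypergraph :: "'a set \<Rightarrow> 'a set set \<Rightarrow> bool" where
  "hypergraph V C \<longleftrightarrow> finite V \<and> (\<forall>E\<in>C. E \<subseteq> V \<and> 2 \<le> card E)
     \<and> (\<forall>E\<in>C. \<forall>E'\<in>C. E \<subseteq> E' \<longrightarrow> E = E')"

definition Ind :: "'a set \<Rightarrow> 'a set set \<Rightarrow> 'a set set" where
  "Ind V C = {\<sigma>. \<sigma> \<subseteq> V \<and> \<not> (\<exists>E\<in>C. E \<subseteq> \<sigma>)}"

text \<open>Geometric realization of a simplicial complex K on the vertex set V, as the set
of barycentric-coordinate functions V -> [0,1] (extended by 0) summing to 1 whose support
is a face of K; it carries the product (= Euclidean) topology of 'a => real.\<close>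
definition realization :: "'a set \<Rightarrow> 'a set set \<Rightarrow> ('a \<Rightarrow> real) set" where
  "realization V K = {f. (\<forall>v. 0 \<le> f v) \<and> (\<forall>v. v \<notin> V \<longrightarrow> f v = 0)
      \<and> sum f V = 1 \<and> {v. f v \<noteq> 0} \<in> K}"

definition nbhd :: "'a set set \<Rightarrow> 'a set \<Rightarrow> 'a set" where
  "nbhd C F = \<Union> {E - F | E. E \<in> C \<and> card (E - F) = 1}"

definition minimal_members :: "'a set set \<Rightarrow> 'a set set" where
  "minimal_members S = {A \<in> S. \<forall>B\<in>S. B \<subseteq> A \<longrightarrow> B = A}"

definition link_vertices :: "'a set \<Rightarrow> 'a set set \<Rightarrow> 'a set \<Rightarrow> 'a set" where
  "link_vertices V C F = V - (F \<union> nbhd C F)"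

definition link_edges :: "'a set set \<Rightarrow> 'a set \<Rightarrow> 'a set set" where
  "link_edges C F = {E \<in> minimal_members ((\<lambda>E. E - F) ` (C - {F})). 2 \<le> card E}"

text \<open>psi computed with a fuel parameter; each recursive call decreases
card V + card C by at least one, so fuel card V + card C + 1 suffices to reach the
base cases and psi agrees with the recursive definition of the paper.\<close>
fun psi_fuel :: "nat \<Rightarrow> 'a set \<Rightarrow> 'a set set \<Rightarrow> enat" where
  "psi_fuel 0 V C = 0"
| "psi_fuel (Suc n) V C =
     (if V = {} then 0
      else if C = {} then \<infinity>
      else Max ((\<lambda>F. min (psi_fuel n V (C - {F}))
                          (psi_fuel n (link_vertices V C F) (link_edges C F) + enat (card F - 1))) ` C))"

definition psi :: "'a set \<Rightarrow> 'a set set \<Rightarrow> enat" where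
  "psi V C = psi_fuel (card V + card C + 1) V C"

end

theory Submission
  imports Defs
begin

text \<open>
  If F is an edge with link complex L = Ind (C : F), then Ind C arises from Ind (C - F) by removing
  the faces containing F, and every proper face of F joins with L inside Ind C. Simple connectivity
  is encoded combinatorially: every local system of sets on the complex (a set over each vertex and
  transport maps along edges, compatible on triangles) has a section. A local system on Ind C
  extends to Ind (C - F): for |F| = 2 the transport along F is a detour through L, well defined
  since L is connected; for |F| = 3 a vertex of L cones off the boundary of F; for |F| \<ge> 4 the
  2-skeleton is unchanged. So by induction every local system on Ind C has a section. Applied
  to the homotopy classes of paths from a base point to the vertices, a section yields a
  homotopy invariant lift of paths over the whole realization, which forces any two paths with
  common endpoints to be homotopic.
\<close>

section \<open>Independence complexes and links of edges\<close>

lemma singleton_in_Ind: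
  assumes "hypergraph V C" "v \<in> V"
  shows "{v} \<in> Ind V C"
proof -
  have False if "E \<in> C" "E \<subseteq> {v}" for E
  proof -
    have "card E \<le> 1" using card_mono[OF _ that(2)] by simp
    moreover have "2 \<le> card E" using assms(1) that(1) by (simp add: hypergraph_def)
    ultimately show False by simp
  qed
  then show ?thesis using assms(2) unfolding Ind_def by blast
qed

lemma Ind_subset: "\<sigma> \<in> Ind V C \<Longrightarrow> \<tau> \<subseteq> \<sigma> \<Longrightarrow> \<tau> \<in> Ind V C"
  unfolding Ind_def by blast

lemma Ind_remove_edge: "\<sigma> \<in> Ind V C \<Longrightarrow> \<sigma> \<in> Ind V (C - {F})"
  by (auto simp: Ind_def)

lemma Ind_insert_edge: "\<sigma> \<in> Ind V (C - {F}) \<Longrightarrow> \<not> F \<subseteq> \<sigma> \<Longrightarrow> \<sigma> \<in> Ind V C"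
  by (auto simp: Ind_def)

lemma hypergraph_remove_edge: "hypergraph V C \<Longrightarrow> hypergraph V (C - {F})"
  by (auto simp: hypergraph_def)

text \<open>Only disjointness from \<open>nbhd C F\<close> is not immediate. A vertex
  \<open>v\<close> of the neighbourhood makes \<open>{v}\<close> one of the traces
  \<open>E - F\<close>, so a minimal trace containing \<open>v\<close> equals \<open>{v}\<close> and
  is too small to be a link edge.\<close>

lemma hypergraph_link:
  assumes "hypergraph V C"
  shows "hypergraph (link_vertices V C F) (link_edges C F)"
proof -
  have "E \<inter> nbhd C F = {}" if E: "E \<in> link_edges C F" for E
  proof (rule ccontr)
    assume "E \<inter> nbhd C F \<noteq> {}"
    then obtain v E1 where v: "v \<in> E" "E1 \<in> C" "card (E1 - F) = 1" "v \<in> E1 - F"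
      by (auto simp: nbhd_def)
    then have eq: "E1 - F = {v}" by (metis card_1_singletonE singletonD)
    then have "E1 \<in> C - {F}" using v by auto
    moreover have "E1 - F \<subseteq> E" using eq v by simp
    ultimately have "E1 - F = E"
      using E unfolding link_edges_def minimal_members_def by blast
    then show False using E v by (auto simp: link_edges_def)
  qed
  moreover have "E \<subseteq> V - F" if "E \<in> link_edges C F" for E
    using that assms by (auto simp: link_edges_def minimal_members_def hypergraph_def)
  moreover have "2 \<le> card E" if "E \<in> link_edges C F" for E
    using that by (simp add: link_edges_def)
  moreover have "E = E'" if "E \<in> link_edges C F" "E' \<in> link_edges C F" "E \<subseteq> E'" for E E'
    using that unfolding link_edges_def minimal_members_def by blast
  moreover have "finite (link_vertices V C F)"
    using assms by (simp add: hypergraph_def link_vertices_def)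
  moreover have "E \<subseteq> link_vertices V C F" if "E \<in> link_edges C F" for E
    using calculation(1,2)[OF that] by (auto simp: link_vertices_def)
  ultimately show ?thesis
    by (simp add: hypergraph_def)
qed

lemma exists_minimal_member:
  assumes "A \<in> S" "finite A"
  shows "\<exists>B\<in>minimal_members S. B \<subseteq> A"
  using assms(2,1)
proof (induction A rule: finite_psubset_induct)
  case (psubset A)
  show ?case
  proof (cases "A \<in> minimal_members S")
    case False
    then obtain B where "B \<in> S" "B \<subset> A"
      using psubset.prems by (auto simp: minimal_members_def)
    then show ?thesis using psubset.IH by (meson order_trans psubset_imp_subset)
  qed auto
qed

text \<open>An edge \<open>E\<close> of \<open>C\<close> inside \<open>A \<union> \<sigma>\<close>
  has its trace \<open>E - F\<close> inside \<open>\<sigma>\<close>. A minimal trace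
  \<open>B\<close> contained in it is nonempty, because edges are incomparable. As a singleton it
  would lie in \<open>nbhd C F\<close>, which \<open>\<sigma>\<close> avoids; otherwise it is a link
  edge inside \<open>\<sigma>\<close>.\<close>

lemma join_link_face:
  assumes h: "hypergraph V C" and F: "F \<in> C" and s: "\<sigma> \<in> Ind (link_vertices V C F) (link_edges C F)"
    and A: "A \<subset> F"
  shows "A \<union> \<sigma> \<in> Ind V C"
proof -
  have sub: "\<sigma> \<subseteq> V - F" "\<sigma> \<inter> nbhd C F = {}"
    using s by (auto simp: Ind_def link_vertices_def)
  have "A \<subseteq> V" using A F h unfolding hypergraph_def by blast
  have False if E: "E \<in> C" "E \<subseteq> A \<union> \<sigma>" for E
  proof -
    have neq: "E \<noteq> F" using E sub A by auto
    then have ne: "\<not> E' \<subseteq> F" if "E' \<in> C - {F}" for E'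
      using h F that by (auto simp: hypergraph_def)
    have "finite (E - F)" using h E by (meson finite_Diff finite_subset hypergraph_def)
    moreover have "E - F \<in> (\<lambda>E. E - F) ` (C - {F})" using E neq by auto
    ultimately obtain B where B: "B \<in> minimal_members ((\<lambda>E. E - F) ` (C - {F}))" "B \<subseteq> E - F"
      using exists_minimal_member by metis
    have Bs: "B \<subseteq> \<sigma>" using B E A by auto
    obtain E' where E': "E' \<in> C - {F}" "B = E' - F"
      using B by (auto simp: minimal_members_def)
    have "finite B" using B(2) \<open>finite (E - F)\<close> finite_subset by blast
    moreover have "B \<noteq> {}" using ne[OF E'(1)] E' by auto
    ultimately have "card B \<noteq> 0" by simp
    then consider "card B = 1" | "2 \<le> card B" by linarith
    then show False
    proof cases
      case 1
      then have "B \<subseteq> nbhd C F" using E' by (auto simp: nbhd_def)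
      then show False using Bs sub \<open>B \<noteq> {}\<close> by auto
    next
      case 2
      then have "B \<in> link_edges C F" using B by (simp add: link_edges_def)
      then show False using Bs s by (auto simp: Ind_def)
    qed
  qed
  then show ?thesis using sub \<open>A \<subseteq> V\<close> by (auto simp: Ind_def)
qed

text \<open>Identifies the third vertex of a triangle containing a two-element \<open>F\<close>. If
  \<open>x\<close> lay in \<open>nbhd C F\<close>, some edge other than \<open>F\<close> would be
  contained in \<open>F \<union> {x}\<close>, hence in the face \<open>\<sigma>\<close>.\<close>

lemma in_link_vertices:
  assumes "F \<in> C" "\<sigma> \<in> Ind V (C - {F})" "F \<subseteq> \<sigma>" "x \<in> \<sigma>" "x \<notin> F"
  shows "x \<in> link_vertices V C F"
proof -
  have "x \<notin> nbhd C F"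
  proof
    assume "x \<in> nbhd C F"
    then obtain E where E: "E \<in> C" "card (E - F) = 1" "x \<in> E - F" by (auto simp: nbhd_def)
    then have "E - F = {x}" by (metis card_1_singletonE singletonD)
    then have "E \<in> C - {F}" "E \<subseteq> \<sigma>" using E assms by auto
    then show False using assms(2) by (auto simp: Ind_def)
  qed
  then show ?thesis using assms by (auto simp: link_vertices_def Ind_def)
qed

section \<open>Lower bounds on psi and connectedness of the 1-skeleton\<close>

text \<open>One unfolding of the recursion, at an edge whose minimum is at least \<open>k\<close>.
  Truncated subtraction makes the bound on the link void as soon as
  \<open>card F > k\<close>.\<close>

lemma psi_fuel_geE:
  assumes k: "enat k \<le> psi_fuel n V C" "0 < k" and h: "hypergraph V C"
  obtains "V \<noteq> {}" "C = {}"
  | m F where "n = Suc m" "V \<noteq> {}" "F \<in> C" "enat k \<le> psi_fuel m V (C - {F})"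
      "enat (k + 1 - card F) \<le> psi_fuel m (link_vertices V C F) (link_edges C F)"
proof (cases n)
  case 0
  then show ?thesis using k by (simp add: zero_enat_def)
next
  case (Suc m)
  have ne: "V \<noteq> {}" using k Suc by (auto simp: zero_enat_def)
  show ?thesis
  proof (cases "C = {}")
    case True
    then show ?thesis using that ne by blast
  next
    case False
    let ?f = "\<lambda>F. min (psi_fuel m V (C - {F}))
       (psi_fuel m (link_vertices V C F) (link_edges C F) + enat (card F - 1))"
    have "finite C" using h by (meson Pow_iff finite_Pow_iff finite_subset hypergraph_def subsetI)
    moreover have "enat k \<le> Max (?f ` C)" using k Suc ne False by simp
    ultimately obtain F where F: "F \<in> C" "enat k \<le> ?f F"
      using False by (auto simp: Max_ge_iff)
    have "2 \<le> card F" using h F by (auto simp: hypergraph_def)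
    moreover have "enat k \<le> psi_fuel m (link_vertices V C F) (link_edges C F) + enat (card F - 1)"
      using F by simp
    ultimately have "enat (k + 1 - card F) \<le> psi_fuel m (link_vertices V C F) (link_edges C F)"
      by (cases "psi_fuel m (link_vertices V C F) (link_edges C F)") auto
    then show ?thesis using that(2)[OF Suc ne F(1)] F by simp
  qed
qed

text \<open>Deleting an edge \<open>F\<close> keeps \<open>V\<close>, so edge paths exist in
  \<open>Ind V (C - {F})\<close> by induction. The only step such a path can take outside
  \<open>Ind V C\<close> is \<open>F\<close> itself, and it is replaced by a detour through a vertex
  of the link.\<close>

lemma skeleton_connected:
  assumes "enat 2 \<le> psi_fuel n V C" "hypergraph V C" "u \<in> V" "v \<in> V"
  shows "(\<lambda>a b. {a, b} \<in> Ind V C)\<^sup>*\<^sup>* u v"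
  using assms
proof (induction n arbitrary: C)
  case 0
  then show ?case by (simp add: zero_enat_def)
next
  case (Suc n)
  show ?case
  proof (rule psi_fuel_geE[OF Suc.prems(1) _ Suc.prems(2)])
    assume "C = {}"
    then have "{u, v} \<in> Ind V C" using Suc.prems by (auto simp: Ind_def)
    then show ?thesis by auto
  next
    fix m F
    assume F: "Suc n = Suc m" "F \<in> C" "enat 2 \<le> psi_fuel m V (C - {F})"
      "enat (2 + 1 - card F) \<le> psi_fuel m (link_vertices V C F) (link_edges C F)"
    have step: "(\<lambda>a b. {a, b} \<in> Ind V C)\<^sup>*\<^sup>* a b" if ab: "{a, b} \<in> Ind V (C - {F})" for a b
    proof (cases "F \<subseteq> {a, b}")
      case False
      then have "{a, b} \<in> Ind V C" using ab Ind_insert_edge by metis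
      then show ?thesis by auto
    next
      case True
      have "2 \<le> card F" using Suc.prems F by (auto simp: hypergraph_def)
      moreover have "card {a, b} \<le> 2" by (simp add: card_insert_if)
      ultimately have eq: "F = {a, b}" "card F = 2"
        using True card_mono[OF _ True] card_seteq[OF _ True] by auto
      then have "a \<noteq> b" by auto
      \<comment> \<open>With \<open>card F = 2\<close> the bound on the link is 1, while
        \<open>psi_fuel\<close> is 0 on an empty vertex set.\<close>
      have "link_vertices V C F \<noteq> {}"
        using F(4) eq by (cases m) (auto simp: zero_enat_def split: if_splits)
      then obtain x where x: "x \<in> link_vertices V C F" by auto
      have "{x} \<in> Ind (link_vertices V C F) (link_edges C F)"
        using x hypergraph_link[OF Suc.prems(2)] singleton_in_Ind by metis
      from join_link_face[OF Suc.prems(2) F(2) this]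
      have "{a, x} \<in> Ind V C" "{x, b} \<in> Ind V C"
        using eq \<open>a \<noteq> b\<close> by (metis insert_is_Un psubsetI subset_insertI singletonD insertI1 insert_commute)+
      then show ?thesis by (meson converse_rtranclp_into_rtranclp rtranclp.rtrancl_refl)
    qed
    have "(\<lambda>a b. {a, b} \<in> Ind V (C - {F}))\<^sup>*\<^sup>* u v"
      using Suc.IH[of "C - {F}"] F Suc.prems hypergraph_remove_edge by auto
    then show ?thesis
      by (induction) (auto intro: rtranclp_trans step)
  qed simp
qed

section \<open>Local systems of sets and their sections\<close>

text \<open>Combinatorial form of a covering space with fibres \<open>X v\<close>. The vertices of a
  triple may coincide: if \<open>K\<close> is closed under subsets, the case \<open>w = u\<close>
  makes the two transports along an edge mutually inverse.\<close>

definition local_system :: "'a set set \<Rightarrow> ('a \<Rightarrow> 'b set) \<Rightarrow> ('a \<Rightarrow> 'a \<Rightarrow> 'b \<Rightarrow> 'b) \<Rightarrow> bool" where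
  "local_system K X g \<longleftrightarrow>
     (\<forall>u v. {u, v} \<in> K \<longrightarrow> (\<forall>x\<in>X u. g u v x \<in> X v)) \<and>
     (\<forall>u. {u} \<in> K \<longrightarrow> (\<forall>x\<in>X u. g u u x = x)) \<and>
     (\<forall>u v w. {u, v, w} \<in> K \<longrightarrow> (\<forall>x\<in>X u. g v w (g u v x) = g u w x))"

definition section_of :: "'a set set \<Rightarrow> ('a \<Rightarrow> 'b set) \<Rightarrow> ('a \<Rightarrow> 'a \<Rightarrow> 'b \<Rightarrow> 'b) \<Rightarrow> ('a \<Rightarrow> 'b) \<Rightarrow> bool" where
  "section_of K X g h \<longleftrightarrow> (\<forall>v. {v} \<in> K \<longrightarrow> h v \<in> X v) \<and> (\<forall>u v. {u, v} \<in> K \<longrightarrow> g u v (h u) = h v)"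

lemma local_system_closed:
  assumes "local_system (Ind V C) X g" "\<sigma> \<in> Ind V C" "u \<in> \<sigma>" "v \<in> \<sigma>" "x \<in> X u"
  shows "g u v x \<in> X v"
proof -
  have "{u, v} \<in> Ind V C" using assms by (auto intro: Ind_subset)
  then show ?thesis using assms unfolding local_system_def by blast
qed

lemma local_system_id:
  assumes "local_system (Ind V C) X g" "\<sigma> \<in> Ind V C" "u \<in> \<sigma>" "x \<in> X u"
  shows "g u u x = x"
proof -
  have "{u} \<in> Ind V C" using assms by (auto intro: Ind_subset)
  then show ?thesis using assms unfolding local_system_def by blast
qed

lemma local_system_comp:
  assumes "local_system (Ind V C) X g" "\<sigma> \<in> Ind V C" "u \<in> \<sigma>" "v \<in> \<sigma>" "w \<in> \<sigma>" "x \<in> X u"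
  shows "g v w (g u v x) = g u w x"
proof -
  have "{u, v, w} \<in> Ind V C" using assms by (auto intro: Ind_subset)
  then show ?thesis using assms unfolding local_system_def by blast
qed

lemmas local_systemD = local_system_closed local_system_id local_system_comp

text \<open>The only new face with at most three vertices is \<open>F\<close>, so no transport has
  to be added. The composition law on \<open>F\<close> follows from the three triangles that join
  \<open>z\<close> to the sides of \<open>F\<close>, all of which are faces of
  \<open>Ind V C\<close>.\<close>

lemma local_system_remove_triangle:
  assumes h: "hypergraph V C" and F: "F \<in> C" "card F = 3" and z: "z \<in> link_vertices V C F"
    and L: "local_system (Ind V C) X g"
  shows "local_system (Ind V (C - {F})) X g"
proof -
  have edge: "{u, v} \<in> Ind V C" if "{u, v} \<in> Ind V (C - {F})" for u v
  proof (rule Ind_insert_edge[OF that])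
    have "card {u, v} \<le> 2" by (simp add: card_insert_if)
    then show "\<not> F \<subseteq> {u, v}" using F card_mono[of "{u,v}" F] by auto
  qed
  have "g v w (g u v x) = g u w x" if uvw: "{u, v, w} \<in> Ind V (C - {F})" and x: "x \<in> X u" for u v w x
  proof (cases "F \<subseteq> {u, v, w}")
    case False
    then have "{u, v, w} \<in> Ind V C" using uvw Ind_insert_edge by metis
    then show ?thesis using local_systemD(3)[OF L] x by simp
  next
    case True
    have "card {u, v, w} \<le> 3" by (simp add: card_insert_if)
    then have eq: "F = {u, v, w}"
      using True card_seteq[OF _ True] F by simp
    have dist: "u \<noteq> v" "v \<noteq> w" "u \<noteq> w"
      using F eq by (auto simp: card_insert_if split: if_splits)
    have sub: "{u, v} \<subset> F" "{v, w} \<subset> F" "{u, w} \<subset> F"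
      unfolding eq using dist by auto
    have zL: "{z} \<in> Ind (link_vertices V C F) (link_edges C F)"
      using z hypergraph_link[OF h] singleton_in_Ind by metis
    have face: "{u, v} \<union> {z} \<in> Ind V C" "{v, w} \<union> {z} \<in> Ind V C" "{u, w} \<union> {z} \<in> Ind V C"
      using join_link_face[OF h F(1) zL sub(1)] join_link_face[OF h F(1) zL sub(2)]
        join_link_face[OF h F(1) zL sub(3)] .
    \<comment> \<open>Three blocks of closure, identity and composition: \<open>D(3)\<close>,
      \<open>D(6)\<close> and \<open>D(9)\<close> are the composition laws on the faces
      \<open>{u, v, z}\<close>, \<open>{v, w, z}\<close> and \<open>{u, w, z}\<close>.\<close>
    note D = local_systemD[OF L face(1)] local_systemD[OF L face(2)] local_systemD[OF L face(3)]
    have gx: "g u v x \<in> X v" using D(1)[of u v] x by auto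
    have "g v w (g u v x) = g z w (g v z (g u v x))" using D(6)[of v z w] gx by simp
    also have "\<dots> = g z w (g u z x)" using D(3)[of u v z] x by simp
    also have "\<dots> = g u w x" using D(9)[of u z w] x by simp
    finally show ?thesis .
  qed
  moreover have "{u} \<in> Ind V C" if "{u} \<in> Ind V (C - {F})" for u
    using edge[of u u] that by simp
  ultimately show ?thesis using L edge unfolding local_system_def by blast
qed

text \<open>The transport along the removed edge is defined by a detour through a vertex of the
  link; it does not depend on the vertex because the link is connected.\<close>
lemma local_system_remove_edge:
  assumes h: "hypergraph V C" and F: "F \<in> C" "card F = 2"
    and ne: "link_vertices V C F \<noteq> {}"
    and con: "\<And>x y. x \<in> link_vertices V C F \<Longrightarrow> y \<in> link_vertices V C F \<Longrightarrow>
      (\<lambda>a b. {a, b} \<in> Ind (link_vertices V C F) (link_edges C F))\<^sup>*\<^sup>* x y"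
    and L: "local_system (Ind V C) X g"
  obtains g' where "local_system (Ind V (C - {F})) X g'"
    "\<And>u v. {u, v} \<in> Ind V C \<Longrightarrow> g' u v = g u v"
proof -
  let ?L = "Ind (link_vertices V C F) (link_edges C F)"
  obtain z where z: "z \<in> link_vertices V C F" using ne by auto
  \<comment> \<open>The vertex \<open>z\<close> is an arbitrary choice, and the test
    \<open>{u, v} = F\<close> covers both orientations of the new edge.\<close>
  define g' where "g' u v = (if {u, v} = F then g z v \<circ> g u z else g u v)" for u v
  have FnI: "\<sigma> \<notin> Ind V C" if "F \<subseteq> \<sigma>" for \<sigma> using F that by (auto simp: Ind_def)
  have old: "g' u v = g u v" if "{u, v} \<in> Ind V C" for u v
    using that FnI[of F] by (auto simp: g'_def)
  have FD: "{u} \<union> \<sigma> \<in> Ind V C" if "u \<in> F" "\<sigma> \<in> ?L" for u \<sigma>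
  proof (rule join_link_face[OF h F(1) that(2)])
    have "F \<noteq> {u}" using F(2) by auto
    then show "{u} \<subset> F" using that by auto
  qed
  have vL: "{x} \<in> ?L" if "x \<in> link_vertices V C F" for x
    using that hypergraph_link[OF h] singleton_in_Ind by metis
  \<comment> \<open>Moves the detour along an edge path of the link starting at \<open>z\<close>.
    For adjacent \<open>y\<close> and \<open>x\<close>, both \<open>{u, y, x}\<close> and
    \<open>{v, y, x}\<close> are faces of \<open>Ind V C\<close>, so passing from \<open>y\<close>
    to \<open>x\<close> does not change the transport.\<close>
  have indep: "g x v (g u x s) = g' u v s"
    if uv: "{u, v} = F" and x: "x \<in> link_vertices V C F" and s: "s \<in> X u" for u v x s
    using con[OF z x]
  proof (induction rule: rtranclp_induct)
    case base
    then show ?case by (simp add: g'_def uv)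
  next
    case (step y x)
    have uF: "u \<in> F" "v \<in> F" using uv by auto
    note Du = local_systemD[OF L FD[OF uF(1) step(2)]]
    note Dv = local_systemD[OF L FD[OF uF(2) step(2)]]
    have uy: "g u y s \<in> X y" using Du(1)[of u y] s by simp
    have "g x v (g u x s) = g x v (g y x (g u y s))" using Du(3)[of u y x] s by simp
    also have "\<dots> = g y v (g u y s)" using Dv(3)[of y x v] uy by simp
    finally show ?case using step by simp
  qed
  have new: "g' u v s \<in> X v" "g' v u (g' u v s) = s" if uv: "{u, v} = F" and s: "s \<in> X u" for u v s
  proof -
    have uF: "u \<in> F" "v \<in> F" using uv by auto
    note Du = local_systemD[OF L FD[OF uF(1) vL[OF z]]]
    note Dv = local_systemD[OF L FD[OF uF(2) vL[OF z]]]
    have uz: "g u z s \<in> X z" using Du(1)[of u z] s by simp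
    then show "g' u v s \<in> X v" using Dv(1)[of z v] uv by (simp add: g'_def)
    \<comment> \<open>The reversed detour undoes the original one leg by leg, first from
      \<open>v\<close> back to \<open>z\<close>, then from \<open>z\<close> back to
      \<open>u\<close>.\<close>
    have "g v z (g z v (g u z s)) = g u z s" using Dv(3)[of z v z] Dv(2)[of z] uz by simp
    moreover have "g z u (g u z s) = s" using Du(3)[of u z u] Du(2)[of u] s by simp
    ultimately show "g' v u (g' u v s) = s"
      using uv by (auto simp: g'_def insert_commute)
  qed
  have single: "{u} \<in> Ind V C" if "{u} \<in> Ind V (C - {F})" for u
    using that singleton_in_Ind[OF h] by (auto simp: Ind_def)
  have id: "g' u u s = s" if "{u} \<in> Ind V (C - {F})" "s \<in> X u" for u s
    using local_systemD(2)[OF L single[OF that(1)]] old[of u u] single that by simp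
  have cl: "g' u v s \<in> X v" if "{u, v} \<in> Ind V (C - {F})" "s \<in> X u" for u v s
  proof (cases "F = {u, v}")
    case True
    then show ?thesis using new that by simp
  next
    case False
    have "\<not> F \<subseteq> {u, v}"
    proof
      assume sub: "F \<subseteq> {u, v}"
      have "card {u, v} \<le> 2" by (simp add: card_insert_if)
      then show False using False card_seteq[OF _ sub] F by simp
    qed
    then have "{u, v} \<in> Ind V C" using Ind_insert_edge that by metis
    then show ?thesis using local_system_closed[OF L, of "{u, v}" u v s] that old by simp
  qed
  have out: "g' a x = g a x" "g' x a = g x a" if "a \<in> F" "x \<in> link_vertices V C F" for a x
    using FD[OF that(1) vL[OF that(2)]] old by (simp_all add: insert_commute)
  have tri: "g' v w (g' u v s) = g' u w s" if uvw: "{u, v, w} \<in> Ind V (C - {F})" and s: "s \<in> X u" for u v w s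
  proof (cases "F \<subseteq> {u, v, w}")
    case False
    then have "{u, v, w} \<in> Ind V C" using uvw Ind_insert_edge by metis
    then have "g v w (g u v s) = g u w s" "{u, v} \<in> Ind V C" "{v, w} \<in> Ind V C" "{u, w} \<in> Ind V C"
      using local_system_comp[OF L, of "{u, v, w}" u v w s] s by (auto intro: Ind_subset)
    then show ?thesis using old by simp
  next
    case True
    have single': "{u} \<in> Ind V (C - {F})" "{v} \<in> Ind V (C - {F})" "{w} \<in> Ind V (C - {F})"
      by (auto intro: Ind_subset[OF uvw])
    have edge: "F = {u, v} \<or> F = {v, w} \<or> F = {u, w}"
    proof -
      obtain a b where "F = {a, b}" "a \<noteq> b" using F by (meson card_2_iff)
      then show ?thesis using True by auto
    qed
    have suv: "g' u v s \<in> X v" using cl[of u v] Ind_subset[OF uvw] s by auto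
    \<comment> \<open>Apart from repeated vertices, exactly one vertex lies outside
      \<open>F\<close>. It belongs to the link, and by \<open>indep\<close> the detour replacing
      \<open>F\<close> may be taken through that very vertex.\<close>
    consider (degen) "u = v \<or> v = w" | (return) "u = w" "F = {u, v}"
      | (first) "F = {u, v}" "w \<notin> F" | (second) "F = {v, w}" "u \<notin> F" | (third) "F = {u, w}" "v \<notin> F"
      using edge F by (auto simp: card_insert_if split: if_splits)
    then show ?thesis
    proof cases
      case degen
      then show ?thesis using id single' s suv by auto
    next
      case return
      then show ?thesis using new s id single' by simp
    next
      case first
      have w: "w \<in> link_vertices V C F" using in_link_vertices[OF F(1) uvw True] first by simp
      note Du = local_systemD[OF L FD[OF _ vL[OF w], of u]]
      note Dv = local_systemD[OF L FD[OF _ vL[OF w], of v]]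
      have uw: "g u w s \<in> X w" using Du(1)[of u w] s first by simp
      have old': "g' v w = g v w" "g' u w = g u w" using out w first by auto
      have "g' v w (g' u v s) = g v w (g w v (g u w s))"
        using indep[OF _ w s] first old' by simp
      also have "\<dots> = g u w s" using Dv(3)[of w v w] Dv(2)[of w] uw first by simp
      finally show ?thesis using old' by simp
    next
      case second
      have u: "u \<in> link_vertices V C F" using in_link_vertices[OF F(1) uvw True] second by simp
      note Dv = local_systemD[OF L FD[OF _ vL[OF u], of v]]
      have old': "g' u v = g u v" "g' u w = g u w" using out u second by auto
      have "g' v w (g' u v s) = g u w (g v u (g u v s))"
        using indep[OF _ u, of v w] suv second old' by simp
      also have "\<dots> = g u w s" using Dv(3)[of u v u] Dv(2)[of u] s second by simp
      finally show ?thesis using old' by simp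
    next
      case third
      have v: "v \<in> link_vertices V C F" using in_link_vertices[OF F(1) uvw True] third by simp
      have old': "g' u v = g u v" "g' v w = g v w" using out v third by auto
      then show ?thesis using indep[OF _ v s] third by simp
    qed
  qed
  have "local_system (Ind V (C - {F})) X g'"
    unfolding local_system_def using cl id tri by blast
  then show ?thesis using that old by blast
qed

text \<open>The induction varies the edges and the transports but keeps \<open>V\<close> and the
  fibres \<open>X\<close>. The element \<open>s\<close> is the seed that is spread over the full
  simplex once all edges have been deleted.\<close>

lemma local_system_has_section:
  assumes "enat 3 \<le> psi_fuel n V C" "hypergraph V C" "local_system (Ind V C) X g"
    "v0 \<in> V" "s \<in> X v0"
  shows "\<exists>h. section_of (Ind V C) X g h"
  using assms
proof (induction n arbitrary: C g)
  case 0
  then show ?case by (simp add: zero_enat_def)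
next
  case (Suc n)
  note h = Suc.prems(2) and L = Suc.prems(3)
  show ?case
  proof (rule psi_fuel_geE[OF Suc.prems(1) _ h])
    assume "C = {}"
    then have "{u, v, w} \<in> Ind V C" if "u \<in> V" "v \<in> V" "w \<in> V" for u v w
      using that by (auto simp: Ind_def)
    note D = local_systemD[OF L this]
    have "g v0 v s \<in> X v" if "v \<in> V" for v
      using D(1)[of v0 v v v0 v s] Suc.prems(4,5) that by simp
    moreover have "g u v (g v0 u s) = g v0 v s" if "u \<in> V" "v \<in> V" for u v
      using D(3)[of v0 u v v0 u v s] Suc.prems(4,5) that by simp
    ultimately have "section_of (Ind V C) X g (\<lambda>v. g v0 v s)"
      by (simp add: section_of_def Ind_def)
    then show ?thesis by blast
  next
    fix m F
    assume F: "Suc n = Suc m" "F \<in> C" "enat 3 \<le> psi_fuel m V (C - {F})"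
      "enat (3 + 1 - card F) \<le> psi_fuel m (link_vertices V C F) (link_edges C F)"
    let ?K = "Ind V (C - {F})"
    have "2 \<le> card F" using h F by (auto simp: hypergraph_def)
    \<comment> \<open>The bound on the link is \<open>4 - card F\<close>: it gives a connected link
      in the first case, a nonempty link in the second, and nothing in the third, where the
      2-skeleton does not change.\<close>
    then consider "card F = 2" | "card F = 3" | "4 \<le> card F" by linarith
    then obtain g' where g': "local_system ?K X g'" "\<And>u v. {u, v} \<in> Ind V C \<Longrightarrow> g' u v = g u v"
    proof cases
      case 1
      have "link_vertices V C F \<noteq> {}"
        using F(4) 1 by (cases m) (auto simp: zero_enat_def split: if_splits)
      moreover have "enat 2 \<le> psi_fuel m (link_vertices V C F) (link_edges C F)"
        using F(4) 1 by simp
      note skeleton_connected[OF this hypergraph_link[OF h]]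
      ultimately show ?thesis
        using local_system_remove_edge[OF h F(2) 1 _ _ L] that by blast
    next
      case 2
      have "link_vertices V C F \<noteq> {}"
        using F(4) 2 by (cases m) (auto simp: zero_enat_def split: if_splits)
      then show ?thesis using local_system_remove_triangle[OF h F(2) 2 _ L] that by blast
    next
      case 3
      have small: "{u, v, w} \<in> Ind V C" if "{u, v, w} \<in> ?K" for u v w
      proof (rule Ind_insert_edge[OF that])
        have "card {u, v, w} \<le> 3" by (simp add: card_insert_if)
        then show "\<not> F \<subseteq> {u, v, w}" using card_mono[of "{u, v, w}" F] 3 by auto
      qed
      have "{u, v} \<in> Ind V C" if "{u, v} \<in> ?K" for u v using small[of u v v] that by simp
      moreover have "{u} \<in> Ind V C" if "{u} \<in> ?K" for u using small[of u u u] that by simp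
      ultimately have "local_system ?K X g"
        using L small unfolding local_system_def by blast
      then show ?thesis using that by blast
    qed
    obtain h' where "section_of ?K X g' h'"
      using Suc.IH[OF _ hypergraph_remove_edge[OF h] g'(1) Suc.prems(4,5)] F by auto
    \<comment> \<open>Every face of \<open>Ind V C\<close> is a face of the larger complex, and
      there \<open>g'\<close> agrees with \<open>g\<close>, so the section restricts.\<close>
    then have "section_of (Ind V C) X g h'"
      using g'(2) Ind_remove_edge unfolding section_of_def by metis
    then show ?thesis by blast
  qed simp
qed

section \<open>Homotopy classes of paths\<close>

definition path_between :: "'n::real_normed_vector set \<Rightarrow> 'n \<Rightarrow> 'n \<Rightarrow> (real \<Rightarrow> 'n) \<Rightarrow> bool" where
  "path_between S x y p \<longleftrightarrow> path p \<and> path_image p \<subseteq> S \<and> pathstart p = x \<and> pathfinish p = y"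

definition path_class :: "'n::real_normed_vector set \<Rightarrow> (real \<Rightarrow> 'n) \<Rightarrow> (real \<Rightarrow> 'n) set" where
  "path_class S p = {q. homotopic_paths S p q}"

text \<open>For fixed \<open>x\<close> and varying \<open>y\<close> these are the fibres of the path
  model of the universal cover.\<close>

definition path_classes :: "'n::real_normed_vector set \<Rightarrow> 'n \<Rightarrow> 'n \<Rightarrow> (real \<Rightarrow> 'n) set set" where
  "path_classes S x y = path_class S ` {p. path_between S x y p}"

text \<open>Ranging over all representatives \<open>q\<close> avoids choosing one; on classes of
  paths this is right concatenation with \<open>p\<close>.\<close>

definition append_path :: "'n::real_normed_vector set \<Rightarrow> (real \<Rightarrow> 'n) \<Rightarrow> (real \<Rightarrow> 'n) set \<Rightarrow> (real \<Rightarrow> 'n) set" where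
  "append_path S p A = {r. \<exists>q\<in>A. homotopic_paths S (q +++ p) r}"

lemma path_between_join:
  "path_between S x y p \<Longrightarrow> path_between S y z q \<Longrightarrow> path_between S x z (p +++ q)"
  by (auto simp: path_between_def path_image_join)

lemma path_between_linepath: "closed_segment x y \<subseteq> S \<Longrightarrow> path_between S x y (linepath x y)"
  by (auto simp: path_between_def)

lemma path_between_homotopic:
  "homotopic_paths S p q \<Longrightarrow> path_between S x y p \<Longrightarrow> path_between S x y q"
  unfolding path_between_def
  by (metis homotopic_paths_imp_path homotopic_paths_imp_pathfinish homotopic_paths_imp_pathstart
      homotopic_paths_imp_subset)

text \<open>The assumption puts \<open>p\<close> into its own class, since homotopy of paths is
  reflexive only on paths inside \<open>S\<close>.\<close>

lemma path_class_eq_iff: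
  assumes "path_between S x y p"
  shows "path_class S p = path_class S q \<longleftrightarrow> homotopic_paths S p q"
proof
  assume "path_class S p = path_class S q"
  moreover have "p \<in> path_class S p" using assms by (simp add: path_class_def path_between_def)
  ultimately show "homotopic_paths S p q"
    by (simp add: path_class_def homotopic_paths_sym)
next
  assume "homotopic_paths S p q"
  then show "path_class S p = path_class S q"
    unfolding path_class_def by (blast intro: homotopic_paths_sym homotopic_paths_trans)
qed

lemma append_path_class:
  assumes "path_between S b x q" "path_between S x y p"
  shows "append_path S p (path_class S q) = path_class S (q +++ p)"
proof (intro set_eqI iffI)
  fix r assume "r \<in> append_path S p (path_class S q)"
  then obtain q' where q': "homotopic_paths S q q'" "homotopic_paths S (q' +++ p) r"
    by (auto simp: append_path_def path_class_def)
  have "homotopic_paths S (q +++ p) (q' +++ p)"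
    using assms q' by (intro homotopic_paths_join) (auto simp: path_between_def)
  then show "r \<in> path_class S (q +++ p)"
    using q' homotopic_paths_trans by (auto simp: path_class_def)
next
  fix r assume "r \<in> path_class S (q +++ p)"
  then show "r \<in> append_path S p (path_class S q)"
    using assms(1) unfolding append_path_def path_class_def path_between_def
    by (auto intro!: exI[of _ q])
qed

lemma append_path_in:
  assumes "A \<in> path_classes S b x" "path_between S x y p"
  shows "append_path S p A \<in> path_classes S b y"
  using assms append_path_class path_between_join unfolding path_classes_def by blast

lemma append_path_join:
  assumes "A \<in> path_classes S b x" "path_between S x y p" "path_between S y z q"
  shows "append_path S q (append_path S p A) = append_path S (p +++ q) A"
proof -
  obtain r where r: "path_between S b x r" "A = path_class S r"
    using assms by (auto simp: path_classes_def)
  have "homotopic_paths S ((r +++ p) +++ q) (r +++ (p +++ q))"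
    using r assms by (intro homotopic_paths_sym[OF homotopic_paths_assoc]) (auto simp: path_between_def)
  then have "path_class S ((r +++ p) +++ q) = path_class S (r +++ (p +++ q))"
    using path_class_eq_iff[OF path_between_join[OF path_between_join[OF r(1) assms(2)] assms(3)]] by simp
  then show ?thesis
    using append_path_class[OF r(1) assms(2)]
      append_path_class[OF path_between_join[OF r(1) assms(2)] assms(3)]
      append_path_class[OF r(1) path_between_join[OF assms(2,3)]] r(2) by simp
qed

lemma append_path_homotopic:
  assumes "A \<in> path_classes S b x" "path_between S x y p" "homotopic_paths S p q"
  shows "append_path S p A = append_path S q A"
proof -
  obtain r where r: "path_between S b x r" "A = path_class S r"
    using assms by (auto simp: path_classes_def)
  have "homotopic_paths S (r +++ p) (r +++ q)"
    using r assms by (intro homotopic_paths_join) (auto simp: path_between_def)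
  then show ?thesis
    using append_path_class[OF r(1) assms(2)] r(2) path_class_eq_iff[OF path_between_join[OF r(1) assms(2)]]
      append_path_class[OF r(1) path_between_homotopic[OF assms(3,2)]] by simp
qed

lemma append_path_const:
  assumes "A \<in> path_classes S b x"
  shows "append_path S (linepath x x) A = A"
proof -
  obtain r where r: "path_between S b x r" "A = path_class S r"
    using assms by (auto simp: path_classes_def)
  have x: "path_between S x x (linepath x x)"
    using r pathfinish_in_path_image[of r] by (auto simp: path_between_def)
  have "homotopic_paths S (r +++ linepath x x) r"
    using r by (intro homotopic_paths_rid') (auto simp: path_between_def)
  then show ?thesis
    using append_path_class[OF r(1) x] r(2) path_class_eq_iff[OF path_between_join[OF r(1) x]] by simp
qed

lemma homotopic_paths_cancel_left:
  assumes "path_between S b x r" "path_between S x y p"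
  shows "homotopic_paths S p (reversepath r +++ (r +++ p))"
proof -
  have "homotopic_paths S p (linepath x x +++ p)"
    using assms by (intro homotopic_paths_sym[OF homotopic_paths_lid']) (auto simp: path_between_def)
  also have "homotopic_paths S \<dots> ((reversepath r +++ r) +++ p)"
    using assms homotopic_paths_sym[OF homotopic_paths_linv[of r S]]
    by (intro homotopic_paths_join) (auto simp: path_between_def)
  also have "homotopic_paths S \<dots> (reversepath r +++ (r +++ p))"
    using assms by (intro homotopic_paths_sym[OF homotopic_paths_assoc]) (auto simp: path_between_def)
  finally show ?thesis .
qed

text \<open>Concatenating with the reverse of a representative of \<open>A\<close> on the left
  cancels it. This turns equal effects on one class back into a homotopy of paths.\<close>

lemma append_path_inj:
  assumes "A \<in> path_classes S b x" "path_between S x y p" "path_between S x y q"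
    and eq: "append_path S p A = append_path S q A"
  shows "homotopic_paths S p q"
proof -
  obtain r where r: "path_between S b x r" "A = path_class S r"
    using assms by (auto simp: path_classes_def)
  have "homotopic_paths S (r +++ p) (r +++ q)"
    using eq append_path_class[OF r(1)] assms(2,3) r(2)
      path_class_eq_iff[OF path_between_join[OF r(1) assms(2)]] by simp
  then have "homotopic_paths S (reversepath r +++ (r +++ p)) (reversepath r +++ (r +++ q))"
    using r assms by (rule_tac homotopic_paths_join) (auto simp: path_between_def)
  then show ?thesis
    using homotopic_paths_cancel_left[OF r(1)] assms(2,3) homotopic_paths_sym homotopic_paths_trans
    by meson
qed

lemma homotopic_in_simply_connected:
  fixes T :: "'n::real_normed_vector set"
  assumes "simply_connected T" "T \<subseteq> S" "path_between T x y p" "path_between T x y q"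
  shows "homotopic_paths S p q"
proof -
  have "homotopic_paths T p q"
    using assms by (auto simp: simply_connected_eq_homotopic_paths path_between_def)
  then show ?thesis using assms(2) homotopic_paths_subset by blast
qed

lemma homotopic_paths_triangle:
  assumes "convex hull {a, b, c} \<subseteq> S"
  shows "homotopic_paths S (linepath a b +++ linepath b c) (linepath a c)"
proof (rule homotopic_in_simply_connected[OF convex_imp_simply_connected[OF convex_convex_hull] assms])
  have sub: "closed_segment u v \<subseteq> convex hull {a, b, c}" if "u \<in> {a, b, c}" "v \<in> {a, b, c}" for u v
    unfolding segment_convex_hull using that by (intro hull_mono) auto
  show "path_between (convex hull {a, b, c}) a c (linepath a b +++ linepath b c)"
    by (intro path_between_join[of _ a b] path_between_linepath sub) auto
  show "path_between (convex hull {a, b, c}) a c (linepath a c)"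
    by (intro path_between_linepath sub) auto
qed

section \<open>Spaces covered by open stars of vertices\<close>

text \<open>Collects what the lifting argument needs from a realization. Stars are starlike about
  their vertices, hence simply connected, and \<open>stars_meet\<close> compares the routes to a
  point from the vertices of two stars containing it.\<close>

locale star_cover =
  fixes S :: "'n::real_normed_vector set" and K :: "'a set set" and vtx :: "'a \<Rightarrow> 'n"
    and St :: "'a \<Rightarrow> 'n set"
  assumes star_open: "{v} \<in> K \<Longrightarrow> openin (top_of_set S) (St v)"
    and star_segment: "{v} \<in> K \<Longrightarrow> x \<in> St v \<Longrightarrow> closed_segment (vtx v) x \<subseteq> St v"
    and vertex_in_star: "{v} \<in> K \<Longrightarrow> vtx v \<in> St v"
    and stars_cover: "x \<in> S \<Longrightarrow> \<exists>v. {v} \<in> K \<and> x \<in> St v"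
    and stars_meet: "x \<in> St u \<Longrightarrow> x \<in> St v \<Longrightarrow> {u, v} \<in> K \<and> convex hull {vtx u, vtx v, x} \<subseteq> S"
    and face: "{u, v, w} \<in> K \<Longrightarrow> convex hull {vtx u, vtx v, vtx w} \<subseteq> S"
begin

lemma star_subset: "{v} \<in> K \<Longrightarrow> St v \<subseteq> S"
  using star_open openin_imp_subset by blast

lemma path_between_edge: "{u, v} \<in> K \<Longrightarrow> path_between S (vtx u) (vtx v) (linepath (vtx u) (vtx v))"
  using face[of u v v] by (intro path_between_linepath) (simp add: segment_convex_hull)

lemma path_between_spoke:
  "{v} \<in> K \<Longrightarrow> x \<in> St v \<Longrightarrow> path_between (St v) (vtx v) x (linepath (vtx v) x)"
  "{v} \<in> K \<Longrightarrow> x \<in> St v \<Longrightarrow> path_between (St v) x (vtx v) (linepath x (vtx v))"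
  using star_segment[of v x] by (auto intro!: path_between_linepath simp: closed_segment_commute)

lemma path_between_mono: "path_between T x y p \<Longrightarrow> T \<subseteq> S' \<Longrightarrow> path_between S' x y p"
  by (auto simp: path_between_def)

lemma star_simply_connected: "{v} \<in> K \<Longrightarrow> simply_connected (St v)"
  using vertex_in_star star_segment
  by (intro starlike_imp_simply_connected) (unfold starlike_def, blast)

text \<open>A point is joined to the vertex of a star containing it by a straight spoke, and
  vertices are joined by edge paths.\<close>

lemma path_connected_of_skeleton:
  assumes "\<And>u v. {u} \<in> K \<Longrightarrow> {v} \<in> K \<Longrightarrow> (\<lambda>a b. {a, b} \<in> K)\<^sup>*\<^sup>* u v"
  shows "path_connected S"
  unfolding path_connected_component
proof (intro ballI)
  have comp: "path_component S x y" if "path_between S x y p" for x y p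
    using that unfolding path_component_def path_between_def by blast
  fix x y assume "x \<in> S" "y \<in> S"
  then obtain u v where uv: "{u} \<in> K" "x \<in> St u" "{v} \<in> K" "y \<in> St v"
    using stars_cover by meson
  from assms[OF uv(1,3)] have "path_component S (vtx u) (vtx v)"
  proof (induction rule: rtranclp_induct)
    case base
    then show ?case
      using star_subset vertex_in_star uv(1) by (blast intro: path_component_refl)
  next
    case (step w v)
    then show ?case using comp[OF path_between_edge] path_component_trans by blast
  qed
  moreover have "path_component S x (vtx u)" "path_component S (vtx v) y"
    using comp path_between_spoke uv path_between_mono star_subset by blast+
  ultimately show "path_component S x y" by (meson path_component_trans)
qed

text \<open>The composition law holds because the triangle spanned by the three vertices lies in
  \<open>S\<close>, so two of its sides are homotopic to the third.\<close>

lemma local_system_path_classes: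
  "local_system K (\<lambda>v. path_classes S b (vtx v)) (\<lambda>u v. append_path S (linepath (vtx u) (vtx v)))"
  unfolding local_system_def
proof (intro conjI allI impI ballI)
  fix u v A assume "{u, v} \<in> K" "A \<in> path_classes S b (vtx u)"
  then show "append_path S (linepath (vtx u) (vtx v)) A \<in> path_classes S b (vtx v)"
    using append_path_in path_between_edge by blast
next
  fix u A assume "A \<in> path_classes S b (vtx u)"
  then show "append_path S (linepath (vtx u) (vtx u)) A = A" by (rule append_path_const)
next
  fix u v w A assume K: "{u, v, w} \<in> K" and A: "A \<in> path_classes S b (vtx u)"
  have sub: "closed_segment x y \<subseteq> S" if "x \<in> {vtx u, vtx v, vtx w}" "y \<in> {vtx u, vtx v, vtx w}" for x y
    unfolding segment_convex_hull using that
    by (intro order_trans[OF hull_mono face[OF K]]) auto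
  have b: "path_between S (vtx u) (vtx v) (linepath (vtx u) (vtx v))"
      "path_between S (vtx v) (vtx w) (linepath (vtx v) (vtx w))"
    by (intro path_between_linepath sub; simp)+
  show "append_path S (linepath (vtx v) (vtx w)) (append_path S (linepath (vtx u) (vtx v)) A)
      = append_path S (linepath (vtx u) (vtx w)) A"
    using append_path_join[OF A b] append_path_homotopic[OF A path_between_join[OF b]
        homotopic_paths_triangle[OF face[OF K]]] by simp
qed

text \<open>The section extends along spokes to a choice \<open>H x\<close> of a class of paths from
  \<open>b\<close> to each point \<open>x\<close>, and every path carries \<open>H\<close> at its
  start to \<open>H\<close> at its end. Two paths with common endpoints thus act equally on one
  class, and \<open>append_path_inj\<close> makes them homotopic.\<close>

lemma simply_connected_of_section:
  assumes sec: "section_of K (\<lambda>v. path_classes S b (vtx v)) (\<lambda>u v. append_path S (linepath (vtx u) (vtx v))) h"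
  shows "simply_connected S"
proof -
  have hX: "h v \<in> path_classes S b (vtx v)" if "{v} \<in> K" for v
    using sec that by (simp add: section_of_def)
  define H where "H x = (let v = SOME v. {v} \<in> K \<and> x \<in> St v in append_path S (linepath (vtx v) x) (h v))" for x
  have spoke: "path_between S (vtx v) x (linepath (vtx v) x)" "path_between S x (vtx v) (linepath x (vtx v))"
    if "{v} \<in> K" "x \<in> St v" for v x
    using path_between_spoke[OF that] path_between_mono star_subset that by blast+
  \<comment> \<open>Independence of the chosen star: the section condition replaces
    \<open>h v\<close> by \<open>h u\<close> followed by the edge from \<open>u\<close> to
    \<open>v\<close>, and the triangle with corners \<open>vtx u\<close>, \<open>vtx v\<close>,
    \<open>x\<close> contracts the resulting route to a single spoke.\<close>
  have H_eq: "H x = append_path S (linepath (vtx v) x) (h v)" if v: "{v} \<in> K" "x \<in> St v" for v x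
  proof -
    define u where "u = (SOME v. {v} \<in> K \<and> x \<in> St v)"
    have u: "{u} \<in> K" "x \<in> St u" using someI[of "\<lambda>v. {v} \<in> K \<and> x \<in> St v" v] v by (auto simp: u_def)
    have uv: "{u, v} \<in> K" "convex hull {vtx u, vtx v, x} \<subseteq> S" using stars_meet[OF u(2) v(2)] by auto
    have "append_path S (linepath (vtx v) x) (h v)
        = append_path S (linepath (vtx v) x) (append_path S (linepath (vtx u) (vtx v)) (h u))"
      using sec uv(1) by (simp add: section_of_def)
    also have "\<dots> = append_path S (linepath (vtx u) (vtx v) +++ linepath (vtx v) x) (h u)"
      using append_path_join hX u path_between_edge uv spoke v by blast
    also have "\<dots> = append_path S (linepath (vtx u) x) (h u)"
      by (rule append_path_homotopic[OF hX[OF u(1)]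
            path_between_join[OF path_between_edge[OF uv(1)] spoke(1)[OF v]] homotopic_paths_triangle[OF uv(2)]])
    finally show ?thesis by (simp add: H_def u_def Let_def)
  qed
  have HX: "H x \<in> path_classes S b x" if x: "x \<in> S" for x
    using stars_cover[OF x] H_eq append_path_in hX spoke by metis
  \<comment> \<open>Inside one star, the spoke to \<open>x\<close> followed by \<open>p\<close> is
    homotopic to the spoke to \<open>y\<close>, because the star is simply connected.\<close>
  have in_star: "append_path S p (H x) = H y"
    if v: "{v} \<in> K" and p: "path_between (St v) x y p" for v x y p
  proof -
    have xy: "x \<in> St v" "y \<in> St v"
      using p pathstart_in_path_image[of p] pathfinish_in_path_image[of p] by (auto simp: path_between_def)
    have pS: "path_between S x y p" using p path_between_mono star_subset v by blast
    have eq: "homotopic_paths S (linepath (vtx v) x +++ p) (linepath (vtx v) y)"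
      using homotopic_in_simply_connected[OF star_simply_connected[OF v] star_subset[OF v]]
        path_between_join path_between_spoke v xy p by blast
    have "append_path S p (H x) = append_path S (linepath (vtx v) x +++ p) (h v)"
      using H_eq[OF v xy(1)] append_path_join[OF hX[OF v] spoke(1)[OF v xy(1)] pS] by simp
    also have "\<dots> = append_path S (linepath (vtx v) y) (h v)"
      using append_path_homotopic[OF hX[OF v] path_between_join[OF spoke(1)[OF v xy(1)] pS] eq] .
    finally show ?thesis using H_eq[OF v xy(2)] by simp
  qed
  have lift: "append_path S p (H x) = H y" if p: "path_between S x y p" for x y p
  proof -
    have pp: "path p" "path_image p \<subseteq> S" "p 0 = x" "p 1 = y"
      using p by (auto simp: path_between_def pathstart_def pathfinish_def)
    have pS: "p t \<in> S" if "t \<in> {0..1}" for t using pp that by (auto simp: path_image_def)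
    have sub: "path_between S (p s) (p t) (subpath s t p)" if "s \<in> {0..1}" "t \<in> {0..1}" for s t
      using that pp path_image_subpath_subset[OF that, of p] by (auto simp: path_between_def)
    \<comment> \<open>\<open>R\<close> is symmetric, transitive and locally true, since
      \<open>p\<close> stays in one star near each time. Connectedness of the unit interval then
      gives \<open>R 0 1\<close>, with no need to subdivide the interval.\<close>
    define R where "R s t \<longleftrightarrow> append_path S (subpath s t p) (H (p s)) = H (p t)" for s t
    have Rtrans: "R s u" if R: "R s t" "R t u" and st: "s \<in> {0..1}" "t \<in> {0..1}" "u \<in> {0..1}" for s t u
    proof -
      have "append_path S (subpath s u p) (H (p s)) = append_path S (subpath s t p +++ subpath t u p) (H (p s))"
        using append_path_homotopic[OF HX[OF pS[OF st(1)]] path_between_join[OF sub[OF st(1,2)] sub[OF st(2,3)]]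
            homotopic_join_subpaths[OF pp(1,2) st]] by simp
      also have "\<dots> = append_path S (subpath t u p) (append_path S (subpath s t p) (H (p s)))"
        using append_path_join[OF HX[OF pS[OF st(1)]] sub[OF st(1,2)] sub[OF st(2,3)]] by simp
      also have "\<dots> = H (p u)" using R by (simp add: R_def)
      finally show ?thesis by (simp add: R_def)
    qed
    have Rsym: "R t s" if R: "R s t" and st: "s \<in> {0..1}" "t \<in> {0..1}" for s t
    proof -
      have "append_path S (subpath t s p) (H (p t)) = append_path S (subpath s t p +++ subpath t s p) (H (p s))"
        using append_path_join[OF HX[OF pS[OF st(1)]] sub[OF st] sub[OF st(2,1)]] R by (simp add: R_def)
      also have "\<dots> = append_path S (subpath s s p) (H (p s))"
        using append_path_homotopic[OF HX[OF pS[OF st(1)]] path_between_join[OF sub[OF st] sub[OF st(2,1)]]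
            homotopic_join_subpaths[OF pp(1,2) st st(1)]] by simp
      also have "\<dots> = H (p s)" using append_path_const[OF HX[OF pS[OF st(1)]]] by (simp add: subpath_refl)
      finally show ?thesis by (simp add: R_def)
    qed
    have local: "\<exists>T. openin (top_of_set {0..1}) T \<and> t \<in> T \<and> (\<forall>s\<in>T. R t s)" if t: "t \<in> {0..1}" for t
    proof -
      obtain v where v: "{v} \<in> K" "p t \<in> St v" using stars_cover[OF pS[OF t]] by blast
      have "openin (top_of_set {0..1}) ({0..1} \<inter> p -` St v)"
        using pp pS star_open[OF v(1)] by (intro continuous_openin_preimage[where T = S]) (auto simp: path_def)
      moreover have "t \<in> {0..1} \<inter> p -` St v" using t v(2) by simp
      ultimately obtain e where e: "e > 0"
          "\<And>s. s \<in> {0..1} \<Longrightarrow> dist s t < e \<Longrightarrow> s \<in> {0..1} \<inter> p -` St v"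
        unfolding openin_euclidean_subtopology_iff by meson
      let ?T = "{0..1} \<inter> ball t e"
      have "R t s" if s: "s \<in> ?T" for s
      proof -
        have "closed_segment t s \<subseteq> ?T"
          using s t e(1) by (intro closed_segment_subset convex_Int) auto
        moreover have "p r \<in> St v" if "r \<in> ?T" for r
          using e(2)[of r] that by (simp add: dist_commute)
        ultimately have "path_image (subpath t s p) \<subseteq> St v"
          unfolding path_image_subpath_gen by blast
        then have "path_between (St v) (p t) (p s) (subpath t s p)"
          using sub[OF t, of s] s by (auto simp: path_between_def)
        then show ?thesis using in_star[OF v(1)] by (simp add: R_def)
      qed
      then show ?thesis using e(1) t by (intro exI[of _ ?T]) (auto simp: openin_open_Int)
    qed
    have "R 0 1"
      by (rule connected_equivalence_relation[of "{0..1::real}" 0 1 R])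
        (rule connected_Icc | (rule Rsym Rtrans local; assumption) | simp)+
    then show ?thesis using pp by (simp add: R_def)
  qed
  have hom: "homotopic_paths S p q" if pq: "path_between S x y p" "path_between S x y q" for x y p q
  proof -
    have "x \<in> S" using pq pathstart_in_path_image[of p] by (auto simp: path_between_def)
    then show ?thesis using append_path_inj[OF HX pq] lift[OF pq(1)] lift[OF pq(2)] by simp
  qed
  \<comment> \<open>\<open>H x\<close> is a class of paths from \<open>b\<close> to
    \<open>x\<close>, so its existence already joins every point to \<open>b\<close>.\<close>
  have "path_connected S"
    unfolding path_connected_component
  proof (intro ballI)
    have ex: "\<exists>p. path_between S b x p" if "x \<in> S" for x
      using HX[OF that] by (auto simp: path_classes_def)
    fix x y assume "x \<in> S" "y \<in> S"
    then obtain p q where "path_between S b x p" "path_between S b y q"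
      using ex by meson
    then have "path_component S b x" "path_component S b y"
      unfolding path_component_def path_between_def by blast+
    then show "path_component S x y" by (meson path_component_sym path_component_trans)
  qed
  then show ?thesis
    unfolding simply_connected_eq_homotopic_paths using hom by (auto simp: path_between_def)
qed

end

section \<open>The realization inside a normed space\<close>

text \<open>Paths are concatenated and contracted with library facts about normed spaces; since
  'a \<Rightarrow> real is not one, the realization is carried over to bounded sequences.\<close>

definition unit_bcontfun :: "nat \<Rightarrow> nat \<Rightarrow>\<^sub>C real" where
  "unit_bcontfun i = Bcontfun (\<lambda>j. if j = i then 1 else 0)"

lemma apply_unit_bcontfun: "apply_bcontfun (unit_bcontfun i) j = (if j = i then 1 else 0)"
proof -
  have "bounded (range (\<lambda>j. if j = i then 1 else 0 :: real))"
    by (rule finite_imp_bounded, rule finite_subset[of _ "{0, 1}"]) auto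
  \<comment> \<open>Continuity is automatic on the discrete space of natural numbers, so boundedness
    is the only condition.\<close>
  then have "(\<lambda>j. if j = i then 1 else 0 :: real) \<in> bcontfun"
    by (simp add: bcontfun_def)
  then show ?thesis by (simp add: unit_bcontfun_def Bcontfun_inverse)
qed

lemma bounded_linear_bcontfun_eval: "bounded_linear (\<lambda>x :: nat \<Rightarrow>\<^sub>C real. apply_bcontfun x i)"
proof (rule bounded_linear_intro[where K = 1])
  fix x :: "nat \<Rightarrow>\<^sub>C real"
  show "norm (apply_bcontfun x i) \<le> norm x * 1" using norm_bounded[of x i] by simp
qed (simp_all add: plus_bcontfun.rep_eq scaleR_bcontfun.rep_eq)

locale finite_complex =
  fixes V :: "'a set" and K :: "'a set set" and idx :: "'a \<Rightarrow> nat"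
  assumes fin: "finite V" and idx: "inj_on idx V" and K_sub: "\<sigma> \<in> K \<Longrightarrow> \<sigma> \<subseteq> V"
    and K_down: "\<sigma> \<in> K \<Longrightarrow> \<tau> \<subseteq> \<sigma> \<Longrightarrow> \<tau> \<in> K"
begin

definition embed :: "('a \<Rightarrow> real) \<Rightarrow> nat \<Rightarrow>\<^sub>C real" where
  "embed f = (\<Sum>v\<in>V. f v *\<^sub>R unit_bcontfun (idx v))"

text \<open>Left inverse of \<open>embed\<close> on functions supported in \<open>V\<close>; the
  value 0 elsewhere matches the convention of \<open>realization\<close>.\<close>

definition coords :: "(nat \<Rightarrow>\<^sub>C real) \<Rightarrow> 'a \<Rightarrow> real" where
  "coords x v = (if v \<in> V then apply_bcontfun x (idx v) else 0)"

lemma coords_embed: "(\<And>v. v \<notin> V \<Longrightarrow> f v = 0) \<Longrightarrow> coords (embed f) = f"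
proof
  fix v assume f: "\<And>v. v \<notin> V \<Longrightarrow> f v = 0"
  show "coords (embed f) v = f v"
  proof (cases "v \<in> V")
    case True
    note lin = bounded_linear.linear[OF bounded_linear_bcontfun_eval[of "idx v"]]
    have "coords (embed f) v = (\<Sum>w\<in>V. f w *\<^sub>R (if idx v = idx w then 1 else 0))"
      unfolding coords_def embed_def linear_sum[OF lin] linear_cmul[OF lin] apply_unit_bcontfun
      using True by (simp only: if_True)
    also have "\<dots> = (\<Sum>w\<in>V. if w = v then f w else 0)"
      using idx True by (intro sum.cong) (auto simp: inj_on_def)
    also have "\<dots> = f v" by (simp only: sum.delta[OF fin] True if_True)
    finally show ?thesis .
  next
    case False
    then show ?thesis using f[OF False] by (simp only: coords_def if_False)
  qed
qed

lemma continuous_on_embed: "continuous_on A embed"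
proof -
  have "continuous_on UNIV embed"
    unfolding embed_def by (intro continuous_intros continuous_on_product_coordinates)
  then show ?thesis by (rule continuous_on_subset) simp
qed

lemma continuous_on_coords: "continuous_on A coords"
proof (rule continuous_on_coordinatewise_then_product)
  fix v show "continuous_on A (\<lambda>x. coords x v)"
    unfolding coords_def
    by (cases "v \<in> V") (auto intro: bounded_linear.continuous_on[OF bounded_linear_bcontfun_eval])
qed

text \<open>A homeomorphic copy of the realization: \<open>embed\<close> and \<open>coords\<close>
  are continuous and mutually inverse between the two sets.\<close>

definition body :: "(nat \<Rightarrow>\<^sub>C real) set" where
  "body = embed ` realization V K"

lemma coords_embed_realization: "f \<in> realization V K \<Longrightarrow> coords (embed f) = f"
  by (rule coords_embed) (auto simp: realization_def)

definition vertex :: "'a \<Rightarrow> nat \<Rightarrow>\<^sub>C real" where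
  "vertex v = embed (\<lambda>w. if w = v then 1 else 0)"

definition star :: "'a \<Rightarrow> (nat \<Rightarrow>\<^sub>C real) set" where
  "star v = {x \<in> body. coords x v \<noteq> 0}"

text \<open>Barycentric coordinates on the closed simplex with vertex set \<open>A\<close>. Summing
  over \<open>V\<close> gives all faces the same normalisation.\<close>

definition face_coords :: "'a set \<Rightarrow> ('a \<Rightarrow> real) set" where
  "face_coords A = {f. (\<forall>v. 0 \<le> f v) \<and> (\<forall>v. v \<notin> A \<longrightarrow> f v = 0) \<and> sum f V = 1}"

lemma simplex_realization: "A \<in> K \<Longrightarrow> face_coords A \<subseteq> realization V K"
proof
  fix f assume A: "A \<in> K" and f: "f \<in> face_coords A"
  have "{v. f v \<noteq> 0} \<subseteq> A" using f by (auto simp: face_coords_def)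
  then have "{v. f v \<noteq> 0} \<in> K" by (rule K_down[OF A])
  moreover have "f v = 0" if "v \<notin> V" for v
    using f K_sub[OF A] that by (auto simp: face_coords_def)
  ultimately show "f \<in> realization V K"
    using f by (simp add: face_coords_def realization_def)
qed

lemma realization_simplex: "f \<in> realization V K \<Longrightarrow> f \<in> face_coords {v. f v \<noteq> 0}"
  by (auto simp: face_coords_def realization_def)

lemma embed_convex_combination:
  "(1 - t) *\<^sub>R embed f + t *\<^sub>R embed g = embed (\<lambda>v. (1 - t) * f v + t * g v)"
  by (simp only: embed_def scaleR_sum_right scaleR_left_distrib sum.distrib scaleR_scaleR)

lemma simplex_convex_combination:
  assumes "f \<in> face_coords A" "g \<in> face_coords A" "0 \<le> t" "t \<le> 1"
  shows "(\<lambda>v. (1 - t) * f v + t * g v) \<in> face_coords A"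
proof -
  have "(\<Sum>v\<in>V. (1 - t) * f v + t * g v) = (1 - t) * sum f V + t * sum g V"
    by (simp only: sum.distrib sum_distrib_left)
  then show ?thesis using assms by (simp add: face_coords_def)
qed

lemma convex_embed_simplex: "convex (embed ` face_coords A)"
  unfolding convex_alt
proof safe
  fix f g and t :: real assume "f \<in> face_coords A" "g \<in> face_coords A" "0 \<le> t" "t \<le> 1"
  then show "(1 - t) *\<^sub>R embed f + t *\<^sub>R embed g \<in> embed ` face_coords A"
    using simplex_convex_combination embed_convex_combination by blast
qed

lemma vertex_simplex: "v \<in> A \<Longrightarrow> A \<in> K \<Longrightarrow> (\<lambda>w. if w = v then 1 else 0) \<in> face_coords A"
  using K_sub fin by (auto simp: face_coords_def)

text \<open>Both hull conditions of \<open>star_cover\<close> reduce to placing three points in one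
  closed simplex, which is convex.\<close>

lemma hull_subset_body:
  assumes "A \<in> K" "X \<subseteq> embed ` face_coords A"
  shows "convex hull X \<subseteq> body"
proof -
  have "convex hull X \<subseteq> embed ` face_coords A"
    using assms(2) convex_embed_simplex by (rule hull_minimal)
  also have "\<dots> \<subseteq> body"
    unfolding body_def using simplex_realization[OF assms(1)] by (rule image_mono)
  finally show ?thesis .
qed

sublocale star_cover body K vertex star
proof
  fix v assume v: "{v} \<in> K"
  have "star v = body \<inter> (\<lambda>x. coords x v) -` (- {0})" by (auto simp: star_def)
  then show "openin (top_of_set body) (star v)"
    using continuous_openin_preimage_gen[of body "\<lambda>x. coords x v" "- {0}"]
      continuous_on_product_then_coordinatewise[OF continuous_on_coords] by auto
  have d: "(\<lambda>w. if w = v then 1 else 0) \<in> realization V K"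
    using vertex_simplex[OF _ v] simplex_realization[OF v] by auto
  then show "vertex v \<in> star v"
    by (simp add: star_def vertex_def body_def coords_embed_realization)
  fix x assume "x \<in> star v"
  then obtain f where f: "f \<in> realization V K" "f v \<noteq> 0" "x = embed f"
    by (auto simp: star_def body_def coords_embed_realization)
  let ?A = "{v. f v \<noteq> 0}"
  have A: "?A \<in> K" using f by (simp add: realization_def)
  show "closed_segment (vertex v) x \<subseteq> star v"
  proof
    fix y assume "y \<in> closed_segment (vertex v) x"
    then obtain t where t: "0 \<le> t" "t \<le> 1" "y = (1 - t) *\<^sub>R vertex v + t *\<^sub>R x"
      by (auto simp: closed_segment_def)
    \<comment> \<open>Moving towards \<open>v\<close> keeps the support inside the face
      \<open>?A\<close>, which contains \<open>v\<close>, and keeps the coordinate at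
      \<open>v\<close> positive. At \<open>t = 0\<close> that coordinate is 1, and for
      \<open>t > 0\<close> the summand \<open>t * f v\<close> is positive.\<close>
    define g where "g = (\<lambda>w. (1 - t) * (if w = v then 1 else 0) + t * f w)"
    have y: "y = embed g"
      using t f by (simp only: vertex_def embed_convex_combination g_def)
    have g: "g \<in> realization V K"
      unfolding g_def using simplex_realization[OF A]
        simplex_convex_combination[OF vertex_simplex[OF _ A] realization_simplex[OF f(1)] t(1,2), of v] f(2)
      by blast
    have "f v > 0" using f by (auto simp: realization_def less_le)
    then have "g v > 0"
      using t(1,2) by (cases "t = 0") (auto simp: g_def intro!: add_nonneg_pos)
    then show "y \<in> star v"
      using g y by (auto simp: star_def body_def coords_embed_realization)
  qed
next
  fix x assume "x \<in> body"
  then obtain f where f: "f \<in> realization V K" "x = embed f" by (auto simp: body_def)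
  then have "sum f V \<noteq> 0" by (simp add: realization_def)
  then obtain v where v: "v \<in> V" "f v \<noteq> 0" by (meson sum.neutral)
  have "{v. f v \<noteq> 0} \<in> K" using f by (simp add: realization_def)
  then have "{v} \<in> K" using v by (auto intro: K_down)
  then show "\<exists>v. {v} \<in> K \<and> x \<in> star v"
    using f v by (auto simp: star_def body_def coords_embed_realization)
next
  fix x u v assume "x \<in> star u" "x \<in> star v"
  then obtain f where f: "f \<in> realization V K" "f u \<noteq> 0" "f v \<noteq> 0" "x = embed f"
    by (auto simp: star_def body_def coords_embed_realization)
  let ?A = "{v. f v \<noteq> 0}"
  have A: "?A \<in> K" using f by (simp add: realization_def)
  \<comment> \<open>A point in two stars has both vertices in its support, and the support is a
    face.\<close>
  have "{u, v} \<in> K" using f by (intro K_down[OF A]) auto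
  moreover have "convex hull {vertex u, vertex v, x} \<subseteq> body"
    using f vertex_simplex[OF _ A] realization_simplex[OF f(1)]
    by (intro hull_subset_body[OF A]) (auto simp: vertex_def)
  ultimately show "{u, v} \<in> K \<and> convex hull {vertex u, vertex v, x} \<subseteq> body" ..
next
  fix u v w assume A: "{u, v, w} \<in> K"
  show "convex hull {vertex u, vertex v, vertex w} \<subseteq> body"
    using vertex_simplex[OF _ A] by (intro hull_subset_body[OF A]) (auto simp: vertex_def)
qed

lemma coords_body: "coords ` body = realization V K"
  by (auto simp: body_def image_image coords_embed_realization)

lemma path_connected_realization: "path_connected body \<Longrightarrow> path_connected (realization V K)"
  using path_connected_continuous_image[OF continuous_on_coords] coords_body by metis

text \<open>Loops are sent to \<open>body\<close> by \<open>embed\<close>, deformed into each other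
  there, and the homotopy is brought back by \<open>coords\<close>. The round trip fixes the
  original loops pointwise.\<close>

lemma simply_connected_realization:
  assumes "simply_connected body"
  shows "simply_connected (realization V K)"
  unfolding simply_connected_def
proof (intro allI impI, elim conjE)
  fix p q
  assume p: "path p" "pathfinish p = pathstart p" "path_image p \<subseteq> realization V K"
    and q: "path q" "pathfinish q = pathstart q" "path_image q \<subseteq> realization V K"
  have "path (embed \<circ> r) \<and> pathfinish (embed \<circ> r) = pathstart (embed \<circ> r) \<and> path_image (embed \<circ> r) \<subseteq> body"
    if "path r" "pathfinish r = pathstart r" "path_image r \<subseteq> realization V K" for r
  proof (intro conjI)
    show "path (embed \<circ> r)" using that(1) continuous_on_embed by (rule path_continuous_image)
    show "pathfinish (embed \<circ> r) = pathstart (embed \<circ> r)"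
      by (simp only: pathfinish_compose pathstart_compose that(2))
    show "path_image (embed \<circ> r) \<subseteq> body"
      unfolding path_image_compose body_def using that(3) by (rule image_mono)
  qed
  from this[OF p] this[OF q] have "homotopic_loops body (embed \<circ> p) (embed \<circ> q)"
    by (intro assms[unfolded simply_connected_def, rule_format]) simp
  then have hom: "homotopic_loops (realization V K) (coords \<circ> (embed \<circ> p)) (coords \<circ> (embed \<circ> q))"
    using coords_body by (intro homotopic_loops_continuous_image[OF _ continuous_on_coords]) auto
  have eq: "homotopic_loops (realization V K) r (coords \<circ> (embed \<circ> r))"
    if r: "path r" "pathfinish r = pathstart r" "path_image r \<subseteq> realization V K" for r
  proof (rule homotopic_loops_eq[OF r(1,3,2)])
    fix t :: real assume "t \<in> {0..1}"
    then have "r t \<in> realization V K" using r(3) by (auto simp: path_image_def)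
    then show "r t = (coords \<circ> (embed \<circ> r)) t" by (simp add: coords_embed_realization)
  qed
  show "homotopic_loops (realization V K) p q"
    by (rule homotopic_loops_trans[OF eq[OF p(1,2,3)]
          homotopic_loops_trans[OF hom homotopic_loops_sym[OF eq[OF q(1,2,3)]]]])
qed

end

theorem theorem3p4:
  fixes V :: "'a set" and C :: "'a set set"
  assumes "hypergraph V C"
  shows "(2 \<le> psi V C \<longrightarrow> path_connected (realization V (Ind V C)))
       \<and> (3 \<le> psi V C \<longrightarrow> simply_connected (realization V (Ind V C)))"
proof -
  have fin: "finite V" using assms by (simp add: hypergraph_def)
  then obtain idx :: "'a \<Rightarrow> nat" where idx: "inj_on idx V" using finite_imp_inj_to_nat_seg by blast
  interpret finite_complex V "Ind V C" idx
  proof (rule finite_complex.intro[OF fin idx])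
    show "\<sigma> \<subseteq> V" if "\<sigma> \<in> Ind V C" for \<sigma> using that by (simp add: Ind_def)
    show "\<tau> \<in> Ind V C" if "\<sigma> \<in> Ind V C" "\<tau> \<subseteq> \<sigma>" for \<sigma> \<tau> using that by (rule Ind_subset)
  qed
  have V_iff: "{v} \<in> Ind V C \<longleftrightarrow> v \<in> V" for v
    using singleton_in_Ind[OF assms] by (auto simp: Ind_def)
  have "path_connected (realization V (Ind V C))" if "2 \<le> psi V C"
  proof (rule path_connected_realization, rule path_connected_of_skeleton)
    fix u v assume "{u} \<in> Ind V C" "{v} \<in> Ind V C"
    then show "(\<lambda>a b. {a, b} \<in> Ind V C)\<^sup>*\<^sup>* u v"
      using skeleton_connected[OF _ assms] that V_iff by (simp only: psi_def numeral_eq_enat)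
  qed
  moreover have "simply_connected (realization V (Ind V C))" if psi: "3 \<le> psi V C"
  proof -
    have 3: "enat 3 \<le> psi_fuel (card V + card C + 1) V C"
      using psi by (simp only: psi_def numeral_eq_enat)
    then have "V \<noteq> {}" by (auto simp: zero_enat_def)
    then obtain v0 where v0: "v0 \<in> V" by auto
    \<comment> \<open>The constant path at \<open>vertex v0\<close> supplies the element of a fibre
      from which the section is built.\<close>
    have "path_between body (vertex v0) (vertex v0) (linepath (vertex v0) (vertex v0))"
      using v0 V_iff by (intro path_between_edge) simp
    then have "path_class body (linepath (vertex v0) (vertex v0)) \<in> path_classes body (vertex v0) (vertex v0)"
      by (auto simp: path_classes_def)
    from local_system_has_section[OF 3 assms local_system_path_classes v0 this]
    show ?thesis using simply_connected_of_section simply_connected_realization by blast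
  qed
  ultimately show ?thesis by blast
qed

end
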